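(* Let $P(x)=x^n+c_{n-1}x^{n-1}+\cdots+c_1x+c_0$ be a monic polynomial of degree $n$ with coefficients $c_i\in\mathbb{H}_{\rm coq}$. Then the zeros of $P$ in $\mathbb{H}_{\rm coq}$ belong to at most $n(2n-1)$ quasi-similarity classes.
   Context: $\mathbb{H}_{\rm coq}$ denotes the real algebra of coquaternions (split quaternions): the $4$-dimensional associative real algebra with basis $1,\mathbf i,\mathbf j,\mathbf k$ and multiplication $\mathbf i^2=-1$, $\mathbf j^2=\mathbf k^2=1$, $\mathbf i\mathbf j=-\mathbf j\mathbf i=\mathbf k$. For $q=q_0+q_1\mathbf i+q_2\mathbf j+q_3\mathbf k$ write $\mathrm{Re}(q)=q_0$ and $\mathrm{dv}(q)=q_1^2-q_2^2-q_3^2$. Two coquaternions $p,q$ are quasi-similar if $\mathrm{Re}(p)=\mathrm{Re}(q)$ and $\mathrm{dv}(p)=\mathrm{dv}(q)$; this is an equivalence relation whose classes are called quasi-similarity classes. A zero of $P(x)=\sum_i c_ix^i$ is an element $z\in\mathbb{H}_{\rm coq}$ with $P(z):=\sum_i c_iz^i=0$ (coefficients on the left). *)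

theory Defs
  imports Complex_Main "HOL-Computational_Algebra.Polynomial"
begin

datatype coquat = Coquat (cq_Re: real) (cq_Im1: real) (cq_Im2: real) (cq_Im3: real)

lemma coquat_eq_iff:
  "p = q \<longleftrightarrow> cq_Re p = cq_Re q \<and> cq_Im1 p = cq_Im1 q \<and> cq_Im2 p = cq_Im2 q \<and> cq_Im3 p = cq_Im3 q"
  by (cases p; cases q) simp

text \<open>The product is the bilinear extension of
  \<open>i\<^sup>2 = -1\<close>, \<open>j\<^sup>2 = k\<^sup>2 = 1\<close>, \<open>ij = -ji = k\<close>, hence \<open>jk = -kj = -i\<close> and \<open>ki = -ik = j\<close>;
  see \<open>coquat_basis_mult\<close> below.\<close>

instantiation coquat :: real_algebra_1
begin

definition zero_coquat :: coquat where "0 = Coquat 0 0 0 0"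

definition one_coquat :: coquat where "1 = Coquat 1 0 0 0"

definition plus_coquat :: "coquat \<Rightarrow> coquat \<Rightarrow> coquat" where
  "p + q = Coquat (cq_Re p + cq_Re q) (cq_Im1 p + cq_Im1 q) (cq_Im2 p + cq_Im2 q) (cq_Im3 p + cq_Im3 q)"

definition minus_coquat :: "coquat \<Rightarrow> coquat \<Rightarrow> coquat" where
  "p - q = Coquat (cq_Re p - cq_Re q) (cq_Im1 p - cq_Im1 q) (cq_Im2 p - cq_Im2 q) (cq_Im3 p - cq_Im3 q)"

definition uminus_coquat :: "coquat \<Rightarrow> coquat" where
  "- q = Coquat (- cq_Re q) (- cq_Im1 q) (- cq_Im2 q) (- cq_Im3 q)"

definition scaleR_coquat :: "real \<Rightarrow> coquat \<Rightarrow> coquat" where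
  "scaleR r q = Coquat (r * cq_Re q) (r * cq_Im1 q) (r * cq_Im2 q) (r * cq_Im3 q)"

definition times_coquat :: "coquat \<Rightarrow> coquat \<Rightarrow> coquat" where
  "p * q = Coquat
     (cq_Re p * cq_Re q - cq_Im1 p * cq_Im1 q + cq_Im2 p * cq_Im2 q + cq_Im3 p * cq_Im3 q)
     (cq_Re p * cq_Im1 q + cq_Im1 p * cq_Re q - cq_Im2 p * cq_Im3 q + cq_Im3 p * cq_Im2 q)
     (cq_Re p * cq_Im2 q + cq_Im2 p * cq_Re q - cq_Im1 p * cq_Im3 q + cq_Im3 p * cq_Im1 q)
     (cq_Re p * cq_Im3 q + cq_Im3 p * cq_Re q + cq_Im1 p * cq_Im2 q - cq_Im2 p * cq_Im1 q)"

instance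
  by standard
    (simp_all add: coquat_eq_iff zero_coquat_def one_coquat_def plus_coquat_def minus_coquat_def
      uminus_coquat_def scaleR_coquat_def times_coquat_def algebra_simps)

end

definition cq_i :: coquat where "cq_i = Coquat 0 1 0 0"
definition cq_j :: coquat where "cq_j = Coquat 0 0 1 0"
definition cq_k :: coquat where "cq_k = Coquat 0 0 0 1"

lemma coquat_basis_mult:
  "cq_i * cq_i = -1" "cq_j * cq_j = 1" "cq_k * cq_k = 1"
  "cq_i * cq_j = cq_k" "cq_j * cq_i = - cq_k"
  "cq_j * cq_k = - cq_i" "cq_k * cq_j = cq_i"
  "cq_k * cq_i = cq_j" "cq_i * cq_k = - cq_j"
  by (simp_all add: cq_i_def cq_j_def cq_k_def one_coquat_def uminus_coquat_def times_coquat_def)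

lemma coquat_expansion:
  "q = of_real (cq_Re q) + cq_Im1 q *\<^sub>R cq_i + cq_Im2 q *\<^sub>R cq_j + cq_Im3 q *\<^sub>R cq_k"
  by (simp add: coquat_eq_iff of_real_def cq_i_def cq_j_def cq_k_def one_coquat_def
      plus_coquat_def scaleR_coquat_def)

definition cq_dv :: "coquat \<Rightarrow> real" where
  "cq_dv q = (cq_Im1 q)\<^sup>2 - (cq_Im2 q)\<^sup>2 - (cq_Im3 q)\<^sup>2"

definition quasi_similar :: "coquat rel" where
  "quasi_similar = {(p, q). cq_Re p = cq_Re q \<and> cq_dv p = cq_dv q}"

lemma equiv_quasi_similar: "equiv UNIV quasi_similar"
  by (rule equivI) (auto simp: quasi_similar_def refl_on_def sym_def trans_def)

text \<open>The library's \<open>poly\<close> needs commutative coefficients, so evaluation with coefficients on the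
  left is defined here.\<close>

definition cq_eval :: "coquat poly \<Rightarrow> coquat \<Rightarrow> coquat" where
  "cq_eval P z = (\<Sum>i\<le>degree P. coeff P i * z ^ i)"

definition cq_zeros :: "coquat poly \<Rightarrow> coquat set" where
  "cq_zeros P = {z. cq_eval P z = 0}"

end

theory Submission
  imports Defs "HOL-Computational_Algebra.Fundamental_Theorem_Algebra"
begin

text \<open>Replacing each coefficient by its four components turns \<open>P\<close> into a coquaternion
  \<open>(p\<^sub>0, p\<^sub>1, p\<^sub>2, p\<^sub>3)\<close> over a commutative polynomial ring. If \<open>z\<close> is a zero of \<open>P\<close>, then \<open>x - z\<close>
  is a right factor of it, so by multiplicativity of the norm the companion polynomial
  \<open>p\<^sub>0\<^sup>2 + p\<^sub>1\<^sup>2 - p\<^sub>2\<^sup>2 - p\<^sub>3\<^sup>2\<close> of degree \<open>2n\<close> is divisible by the norm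
  \<open>x\<^sup>2 - 2 Re(z) x + Re(z)\<^sup>2 + dv(z)\<close> of \<open>x - z\<close>. This quadratic determines the quasi-similarity
  class of \<open>z\<close>, and its complex roots form one of the at most \<open>2n choose 2\<close> submultisets of size \<open>2\<close>
  of the roots of the companion polynomial.\<close>

text \<open>Pascal's rule by induction on \<open>A\<close>: a submultiset of
  \<open>add_mset x A\<close> either contains \<open>x\<close>, which can be removed, or already
  lies in \<open>A\<close>. Repeated elements of \<open>A\<close> make these cases overlap, hence
  only an inequality.\<close>

lemma card_submultisets_le:
  "finite {M. M \<subseteq># A \<and> size M = k} \<and> card {M. M \<subseteq># A \<and> size M = k} \<le> size A choose k"
proof (induction A arbitrary: k)
  case empty
  have eq: "{M. M \<subseteq># {#} \<and> size M = k} = (if k = 0 then {{#}} else {})"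
    by auto
  show ?case
    unfolding eq by simp
next
  case (add x A)
  show ?case
  proof (cases k)
    case 0
    then have "{M. M \<subseteq># add_mset x A \<and> size M = k} = {{#}}"
      by auto
    then show ?thesis
      using 0 by simp
  next
    case (Suc j)
    let ?S = "\<lambda>k. {M. M \<subseteq># A \<and> size M = k}"
    have sub: "{M. M \<subseteq># add_mset x A \<and> size M = k} \<subseteq> ?S (Suc j) \<union> add_mset x ` ?S j"
    proof
      fix M assume M: "M \<in> {M. M \<subseteq># add_mset x A \<and> size M = k}"
      show "M \<in> ?S (Suc j) \<union> add_mset x ` ?S j"
      proof (cases "x \<in># M")
        case True
        then obtain N where "M = add_mset x N"
          by (metis insert_DiffM)
        then show ?thesis
          using M Suc by auto
      next
        case False
        then have "M \<subseteq># A"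
          using M by (metis mem_Collect_eq add_mset_remove_trivial diff_single_trivial
              subset_eq_diff_conv union_single_eq_member add_mset_add_single)
        then show ?thesis
          using M Suc by simp
      qed
    qed
    have fin: "finite (?S (Suc j) \<union> add_mset x ` ?S j)"
      using add.IH by blast
    have "card (add_mset x ` ?S j) \<le> size A choose j"
      using add.IH[of j] card_image_le[of "?S j" "add_mset x"] by linarith
    then have "card (?S (Suc j) \<union> add_mset x ` ?S j) \<le> size (add_mset x A) choose k"
      using card_Un_le[of "?S (Suc j)" "add_mset x ` ?S j"] add.IH[of "Suc j"] Suc by simp
    then show ?thesis
      using finite_subset[OF sub fin] card_mono[OF fin sub] by linarith
  qed
qed

text \<open>Horner's rule. With coefficients on the left, the extra factor \<open>z\<close> must
  come out on the right.\<close>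

lemma cq_eval_pCons: "cq_eval (pCons c P) z = c + cq_eval P z * z"
proof (cases "P = 0")
  case True
  then show ?thesis
    by (simp add: cq_eval_def)
next
  case False
  have "cq_eval (pCons c P) z = c + (\<Sum>i\<le>degree P. coeff P i * z ^ Suc i)"
    using False by (simp add: cq_eval_def sum.atMost_Suc_shift del: power_Suc sum.atMost_Suc)
  also have "\<dots> = c + cq_eval P z * z"
    by (simp add: cq_eval_def sum_distrib_right power_Suc2 mult.assoc del: power_Suc)
  finally show ?thesis .
qed

text \<open>The values are real, but they are embedded in the complex numbers so that all
  polynomials built from them split into linear factors.\<close>

definition cq_comp :: "(coquat \<Rightarrow> real) \<Rightarrow> coquat poly \<Rightarrow> complex poly" where
  "cq_comp f P = map_poly (\<lambda>c. of_real (f c)) P"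

definition cq_companion :: "coquat poly \<Rightarrow> complex poly" where
  "cq_companion P = (cq_comp cq_Re P)\<^sup>2 + (cq_comp cq_Im1 P)\<^sup>2
     - (cq_comp cq_Im2 P)\<^sup>2 - (cq_comp cq_Im3 P)\<^sup>2"

definition cq_charpoly :: "coquat \<Rightarrow> complex poly" where
  "cq_charpoly z = [:of_real ((cq_Re z)\<^sup>2 + cq_dv z), of_real (- 2 * cq_Re z), 1:]"

lemma coeff_cq_comp:
  assumes "f 0 = 0"
  shows "coeff (cq_comp f P) i = of_real (f (coeff P i))"
  using assms by (simp add: cq_comp_def coeff_map_poly)

lemma degree_cq_comp_le: "degree (cq_comp f P) \<le> degree P"
  by (simp add: cq_comp_def map_poly_degree_leq)

lemma cq_comp_pCons:
  assumes "f 0 = 0"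
  shows "cq_comp f (pCons c P) = [:of_real (f c):] + [:0, 1:] * cq_comp f P"
  using assms by (simp add: cq_comp_def map_poly_pCons)

text \<open>The remainder theorem \<open>P(x) = L(x) (x - z) + P(z)\<close>, written out in components because
  the library has no product of polynomials with noncommuting coefficients.\<close>

lemma cq_comp_remainder:
  fixes z :: coquat
  defines "w0 \<equiv> [:0, 1:] - [:complex_of_real (cq_Re z):]"
    and "w1 \<equiv> - [:complex_of_real (cq_Im1 z):]"
    and "w2 \<equiv> - [:complex_of_real (cq_Im2 z):]"
    and "w3 \<equiv> - [:complex_of_real (cq_Im3 z):]"
  shows "\<exists>l0 l1 l2 l3.
    cq_comp cq_Re P = l0 * w0 - l1 * w1 + l2 * w2 + l3 * w3 + [:of_real (cq_Re (cq_eval P z)):] \<and>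
    cq_comp cq_Im1 P = l0 * w1 + l1 * w0 - l2 * w3 + l3 * w2 + [:of_real (cq_Im1 (cq_eval P z)):] \<and>
    cq_comp cq_Im2 P = l0 * w2 + l2 * w0 - l1 * w3 + l3 * w1 + [:of_real (cq_Im2 (cq_eval P z)):] \<and>
    cq_comp cq_Im3 P = l0 * w3 + l3 * w0 + l1 * w2 - l2 * w1 + [:of_real (cq_Im3 (cq_eval P z)):]"
proof (induction P)
  case 0
  show ?case
    by (intro exI[of _ 0]) (simp add: cq_comp_def cq_eval_def, simp add: zero_coquat_def)
next
  case (pCons c P)
  define K where "K r = [:complex_of_real r:]" for r
  have K: "K (r + s) = K r + K s" "K (r - s) = K r - K s" "K (r * s) = K r * K s" for r s
    by (simp_all add: K_def)
  define x :: "complex poly" where "x = [:0, 1:]"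
  have w: "w0 = x - K (cq_Re z)" "w1 = - K (cq_Im1 z)" "w2 = - K (cq_Im2 z)" "w3 = - K (cq_Im3 z)"
    by (simp_all add: w0_def w1_def w2_def w3_def x_def K_def)
  have comp: "cq_comp f (pCons c P) = K (f c) + x * cq_comp f P" if "f 0 = 0" for f
    using cq_comp_pCons[where f = f, OF that] by (simp only: K_def x_def)
  define r where "r = cq_eval P z"
  obtain l0 l1 l2 l3 where l:
    "cq_comp cq_Re P = l0 * w0 - l1 * w1 + l2 * w2 + l3 * w3 + K (cq_Re r)"
    "cq_comp cq_Im1 P = l0 * w1 + l1 * w0 - l2 * w3 + l3 * w2 + K (cq_Im1 r)"
    "cq_comp cq_Im2 P = l0 * w2 + l2 * w0 - l1 * w3 + l3 * w1 + K (cq_Im2 r)"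
    "cq_comp cq_Im3 P = l0 * w3 + l3 * w0 + l1 * w2 - l2 * w1 + K (cq_Im3 r)"
    using pCons.IH unfolding K_def r_def by blast
  have zero: "cq_Re 0 = 0" "cq_Im1 0 = 0" "cq_Im2 0 = 0" "cq_Im3 0 = 0"
    by (simp_all add: zero_coquat_def)
  show ?case
    unfolding cq_eval_pCons comp[of cq_Re, OF zero(1)] comp[of cq_Im1, OF zero(2)]
      comp[of cq_Im2, OF zero(3)] comp[of cq_Im3, OF zero(4)]
      K_def[symmetric] r_def[symmetric] l
    \<comment> \<open>The new quotient is \<open>x L + r\<close>: from
      \<open>P = L (x - z) + r\<close> follows
      \<open>c + x P = (x L + r) (x - z) + (c + r z)\<close>, as \<open>x\<close> is
      central.\<close>
    by (rule exI[of _ "x * l0 + K (cq_Re r)"], rule exI[of _ "x * l1 + K (cq_Im1 r)"],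
        rule exI[of _ "x * l2 + K (cq_Im2 r)"], rule exI[of _ "x * l3 + K (cq_Im3 r)"])
      (simp add: plus_coquat_def times_coquat_def K w algebra_simps)
qed

lemma cq_charpoly_dvd_companion:
  assumes "cq_eval P z = 0"
  shows "cq_charpoly z dvd cq_companion P"
proof -
  define w0 where "w0 = [:0, 1:] - [:complex_of_real (cq_Re z):]"
  define w1 where "w1 = - [:complex_of_real (cq_Im1 z):]"
  define w2 where "w2 = - [:complex_of_real (cq_Im2 z):]"
  define w3 where "w3 = - [:complex_of_real (cq_Im3 z):]"
  obtain l0 l1 l2 l3 where l:
    "cq_comp cq_Re P = l0 * w0 - l1 * w1 + l2 * w2 + l3 * w3"
    "cq_comp cq_Im1 P = l0 * w1 + l1 * w0 - l2 * w3 + l3 * w2"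
    "cq_comp cq_Im2 P = l0 * w2 + l2 * w0 - l1 * w3 + l3 * w1"
    "cq_comp cq_Im3 P = l0 * w3 + l3 * w0 + l1 * w2 - l2 * w1"
    using cq_comp_remainder[of P z] assms
    by (auto simp: w0_def w1_def w2_def w3_def zero_coquat_def)
  \<comment> \<open>Euler's four-square identity in split signature.\<close>
  have "cq_companion P = (w0\<^sup>2 + w1\<^sup>2 - w2\<^sup>2 - w3\<^sup>2) * (l0\<^sup>2 + l1\<^sup>2 - l2\<^sup>2 - l3\<^sup>2)"
    unfolding cq_companion_def l by (simp add: power2_eq_square algebra_simps)
  also have "w0\<^sup>2 + w1\<^sup>2 - w2\<^sup>2 - w3\<^sup>2 = cq_charpoly z"
    by (simp add: w0_def w1_def w2_def w3_def cq_charpoly_def cq_dv_def power2_eq_square)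
  finally show ?thesis
    by simp
qed

lemma degree_cq_companion_le: "degree (cq_companion P) \<le> 2 * degree P"
proof -
  have "degree ((cq_comp f P)\<^sup>2) \<le> 2 * degree P" for f
    using degree_power_le[of "cq_comp f P" 2] degree_cq_comp_le[of f P] by linarith
  then show ?thesis
    unfolding cq_companion_def by (intro degree_diff_le degree_add_le)
qed

text \<open>Only a degree bound is assumed, since a component of \<open>P\<close> may have smaller
  degree than \<open>P\<close>; then both sides vanish.\<close>

lemma coeff_power2_degree_bound:
  fixes p :: "'a :: comm_semiring_1 poly"
  assumes "degree p \<le> n"
  shows "coeff (p\<^sup>2) (n + n) = (coeff p n)\<^sup>2"
proof (cases "degree p = n")
  case True
  then show ?thesis
    using coeff_mult_degree_sum[of p p] by (simp add: power2_eq_square)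
next
  case False
  then have "degree p < n"
    using assms by simp
  moreover from this have "degree (p\<^sup>2) < n + n"
    using degree_power_le[of p 2] by linarith
  ultimately show ?thesis
    by (simp add: coeff_eq_0)
qed

lemma cq_companion_nonzero:
  assumes "lead_coeff P = 1"
  shows "cq_companion P \<noteq> 0"
proof -
  let ?n = "degree P"
  have sq: "coeff ((cq_comp f P)\<^sup>2) (?n + ?n) = (of_real (f 1))\<^sup>2" if "f 0 = 0" for f
    using coeff_power2_degree_bound[OF degree_cq_comp_le, of f P] coeff_cq_comp[where f = f, OF that] assms by simp
  \<comment> \<open>The leading coefficient \<open>1\<close> has components 1, 0, 0, 0, so the top
    terms of the squares cannot cancel.\<close>
  have "coeff (cq_companion P) (?n + ?n) = 1"
    by (simp add: cq_companion_def sq zero_coquat_def one_coquat_def)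
  then show ?thesis
    by auto
qed

lemma cq_charpoly_eq_iff: "cq_charpoly p = cq_charpoly q \<longleftrightarrow> (p, q) \<in> quasi_similar"
  by (auto simp: cq_charpoly_def quasi_similar_def simp del: of_real_add of_real_power of_real_mult)

lemma proots_monic_complex_inject:
  fixes p q :: "complex poly"
  assumes "lead_coeff p = 1" "lead_coeff q = 1" "proots p = proots q"
  shows "p = q"
  using assms complex_poly_decompose_multiset[of p] complex_poly_decompose_multiset[of q] by simp

lemma lead_coeff_cq_charpoly: "lead_coeff (cq_charpoly z) = 1"
  by (simp add: cq_charpoly_def)

lemma proots_cq_charpoly_eq_iff:
  "proots (cq_charpoly p) = proots (cq_charpoly q) \<longleftrightarrow> (p, q) \<in> quasi_similar"
  using cq_charpoly_eq_iff proots_monic_complex_inject lead_coeff_cq_charpoly by metis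

lemma proots_subset_if_dvd:
  fixes p q :: "'a :: idom poly"
  assumes "p dvd q" "q \<noteq> 0"
  shows "proots p \<subseteq># proots q"
  using assms by (auto simp: proots_mult elim!: dvdE)

theorem theorem3p10:
  fixes P :: "coquat poly" and n :: nat
  assumes "degree P = n" and "lead_coeff P = 1"
  shows "finite (cq_zeros P // quasi_similar) \<and>
         card (cq_zeros P // quasi_similar) \<le> n * (2 * n - 1)"
proof -
  define A where "A = proots (cq_companion P)"
  define S where "S = {M. M \<subseteq># A \<and> size M = 2}"
  \<comment> \<open>\<open>g\<close> recovers a class from its root multiset. It is empty on pairs
    that do not arise, which is harmless for an upper bound.\<close>
  define g where "g M = {q. M = proots (cq_charpoly q)}" for M
  have fin: "finite S"
    using card_submultisets_le[of A 2] by (simp add: S_def)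
  have sub: "cq_zeros P // quasi_similar \<subseteq> g ` S"
  proof
    fix c assume "c \<in> cq_zeros P // quasi_similar"
    then obtain z where z: "cq_eval P z = 0" and c: "c = quasi_similar `` {z}"
      by (auto simp: quotient_def cq_zeros_def)
    have "proots (cq_charpoly z) \<subseteq># A"
      unfolding A_def
      using z assms(2)
      by (intro proots_subset_if_dvd cq_charpoly_dvd_companion cq_companion_nonzero)
    \<comment> \<open>Roots count with multiplicity, so a double root also gives size 2.\<close>
    moreover have "size (proots (cq_charpoly z)) = 2"
      by (simp add: size_proots_complex cq_charpoly_def)
    moreover have "c = g (proots (cq_charpoly z))"
      by (auto simp: c g_def proots_cq_charpoly_eq_iff)
    ultimately show "c \<in> g ` S"
      by (auto simp: S_def)
  qed
  have "size A \<le> 2 * n"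
    using degree_cq_companion_le[of P] assms(1) by (simp add: A_def size_proots_complex)
  then have "size A choose 2 \<le> (2 * n) choose 2"
    by (rule binomial_right_mono)
  also have "(2 * n) choose 2 = n * (2 * n - 1)"
    by (simp add: choose_two)
  finally have "card S \<le> n * (2 * n - 1)"
    using card_submultisets_le[of A 2] unfolding S_def by linarith
  moreover have "card (cq_zeros P // quasi_similar) \<le> card S"
    using sub fin by (rule surj_card_le[rotated])
  ultimately show ?thesis
    using finite_subset[OF sub] fin by simp
qed

end
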